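(* Let $n\ge2$ and let $d\in\mathbb{R}^{n\times n}$ be symmetric with zero diagonal and positive off-diagonal entries, of strict negative type. Run the shadowed certified peeling algorithm (described in the context, in exact arithmetic) on $d$, and index its Phase II checks by $i=0,1,\dots$. Let $c_{(i)}$ be the value of $c$ at check $i$, let $\pi_{(i)}$ be $b$ if $q_b>c$ at check $i$ and $p$ otherwise (where $b,q_b$ are the values at check $i$, before the shadow step that follows that check), and put $r_{(0)}:=1-c_{(0)}/c_*$. Then for every $i$, $$1-\frac{q(\pi_{(i)})}{c_*}\le\Bigl(\frac1{r_{(0)}}+\frac i4\Bigr)^{-1}\le\frac4{i+4},$$ equivalently $$c_*-q(\pi_{(i)})\le\frac{4c_*}{i+4}\le\frac{4d_{\max}}{i+4}$$ (where if $r_{(0)}=0$ the middle quantity $(1/r_{(0)}+i/4)^{-1}$ is read as $0$). This holds for every such $d$ and every trajectory of the algorithm. Moreover $q(\pi_{(i)})\ge c_{(i)}$ at every check, and $c_*\in[\,q(\pi_{(i)}),\,q_w+G_w\,]$, where $q_w,G_w$ are the values computed in the shadow step following check $i$.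
   Context: Write $[n]=\{1,\dots,n\}$, $1$ for the all-ones vector, $e_j$ for the standard basis. The matrix $d$ is of strict negative type if $v^Tdv<0$ for every $v\ne0$ with $1^Tv=0$ (no triangle inequality is assumed). $\Delta_{n-1}=\{p\in[0,1]^n:1^Tp=1\}$, $q(p)=p^Tdp$, $c_*=\max_{p\in\Delta_{n-1}}q(p)$, $d_{\max}=\max_{i,j}d_{ij}$. For $\mathcal{J}\subseteq[n]$ with $|\mathcal{J}|\ge2$, let $w_{\mathcal{J}}=d_{\mathcal{J},\mathcal{J}}^{-1}1_{\mathcal{J}}$ (the principal submatrix $d_{\mathcal{J},\mathcal{J}}$ is invertible), and let $p^{\mathcal{J}}\in\mathbb{R}^n$ be equal to $w_{\mathcal{J}}/(1_{\mathcal{J}}^Tw_{\mathcal{J}})$ on $\mathcal{J}$ and $0$ off $\mathcal{J}$. Shadowed certified peeling algorithm. (Phase I) $\mathcal{J}\leftarrow[n]$, $p\leftarrow p^{\mathcal{J}}$. While $\min_jp_j<0$: $\mathcal{J}\leftarrow\{j:p_j>0\}$, $p\leftarrow p^{\mathcal{J}}$. Then $g\leftarrow dp$, $c\leftarrow p^Tg$, $k\leftarrow\arg\max_jg_j$, and initialize the shadow: $b\leftarrow p$, $q_b\leftarrow c$. (Phase II) A check is an evaluation of the predicate $g_k>c$. While $g_k>c$: (Shadow step) If $c\ge q_b$: set $w\leftarrow p$, $q_w\leftarrow c$, $G_w\leftarrow2(g_k-c)$, $k_w\leftarrow k$. Otherwise: set $w\leftarrow b$, $h\leftarrow db$, $q_w\leftarrow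 b^Th$, $G_w\leftarrow2(\max_jh_j-q_w)$, $k_w\leftarrow\arg\max_jh_j$. Then $\gamma\leftarrow G_w/(2(G_w+q_w))$, $b\leftarrow w+\gamma(e_{k_w}-w)$, $q_b\leftarrow q_w+G_w^2/(4(G_w+q_w))$. (Phase III) $\mathcal{J}\leftarrow\operatorname{supp}(p)\cup\{k\}$, $y\leftarrow p^{\mathcal{J}}$; while $\min_{j\in\mathcal{J}}y_j<0$: $t\leftarrow\min\{p_i/(p_i-y_i):y_i<0\}$, $p\leftarrow p+t(y-p)$, $\mathcal{J}\leftarrow\{j:p_j>0\}$, $y\leftarrow p^{\mathcal{J}}$. Then $p\leftarrow y$, $g\leftarrow dp$, $c\leftarrow p^Tg$, $k\leftarrow\arg\max_jg_j$. When $g_k\le c$, return $p$. (If the run is stopped early at a check, the point returned is $b$ if $q_b>c$ and $p$ otherwise.) *)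

theory Defs
  imports "HOL-Analysis.Analysis"
begin

text \<open>
  The index set is a finite type \<open>'n\<close>, so \<open>n\<close> is \<open>CARD('n)\<close> and \<open>d\<close> has type \<open>real^'n^'n\<close>.
\<close>

definition strict_negative_type :: "real^'n^'n \<Rightarrow> bool" where
  "strict_negative_type d \<longleftrightarrow>
     (\<forall>v. v \<noteq> 0 \<and> (\<Sum>i\<in>UNIV. v $ i) = 0 \<longrightarrow> v \<bullet> (d *v v) < 0)"

definition prob_simplex :: "(real^'n) set" where
  "prob_simplex = {p. (\<forall>i. 0 \<le> p $ i \<and> p $ i \<le> 1) \<and> (\<Sum>i\<in>UNIV. p $ i) = 1}"

definition qform :: "real^'n^'n \<Rightarrow> real^'n \<Rightarrow> real" where
  "qform d p = p \<bullet> (d *v p)"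

definition c_star :: "real^'n^'n \<Rightarrow> real" where
  "c_star d = (GREATEST c. c \<in> qform d ` prob_simplex)"

definition d_max :: "real^'n^'n \<Rightarrow> real" where
  "d_max d = Max (range (\<lambda>(i, j). d $ i $ j))"

text \<open>
  A matrix or vector indexed by \<open>J\<close> is represented by its extension by zero to the full index
  type. The inverse of the principal submatrix is accordingly the inverse in the ring of
  matrices supported on \<open>J \<times> J\<close>, whose unit is \<open>principal (mat 1) J\<close>.
\<close>

definition principal :: "real^'n^'n \<Rightarrow> 'n set \<Rightarrow> real^'n^'n" where
  "principal A J = (\<chi> i j. if i \<in> J \<and> j \<in> J then A $ i $ j else 0)"

definition principal_inv :: "real^'n^'n \<Rightarrow> 'n set \<Rightarrow> real^'n^'n" where
  "principal_inv A J =
     (SOME B. principal B J = B \<and>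
              principal A J ** B = principal (mat 1) J \<and>
              B ** principal A J = principal (mat 1) J)"

definition ones_on :: "'n set \<Rightarrow> real^'n" where
  "ones_on J = (\<chi> i. if i \<in> J then 1 else 0)"

definition w_on :: "real^'n^'n \<Rightarrow> 'n set \<Rightarrow> real^'n" where
  "w_on d J = principal_inv d J *v ones_on J"

definition p_on :: "real^'n^'n \<Rightarrow> 'n set \<Rightarrow> real^'n" where
  "p_on d J = (1 / (ones_on J \<bullet> w_on d J)) *\<^sub>R w_on d J"

definition is_argmax :: "real^'n \<Rightarrow> 'n \<Rightarrow> bool" where
  "is_argmax g k \<longleftrightarrow> (\<forall>j. g $ j \<le> g $ k)"

text \<open>
  The algorithm is a relation rather than a function because ties in the argmax steps may be
  broken arbitrarily.

  \<open>phase1 d J p\<close>: the values \<open>J\<close>, \<open>p\<close> occur at the head of the Phase I loop.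
\<close>

inductive phase1 :: "real^'n^'n \<Rightarrow> 'n set \<Rightarrow> real^'n \<Rightarrow> bool" for d :: "real^'n^'n" where
  phase1_init: "phase1 d UNIV (p_on d UNIV)"
| phase1_step: "phase1 d J p \<Longrightarrow> (MIN j. p $ j) < 0 \<Longrightarrow> J' = {j. p $ j > 0} \<Longrightarrow>
    phase1 d J' (p_on d J')"

text \<open>
  \<open>phase3 d p0 k p J y\<close>: the values \<open>p\<close>, \<open>J\<close>, \<open>y\<close> occur at the head of the Phase III loop,
  when Phase III was entered with \<open>p0\<close> and \<open>k\<close>.
\<close>

inductive phase3 :: "real^'n^'n \<Rightarrow> real^'n \<Rightarrow> 'n \<Rightarrow> real^'n \<Rightarrow> 'n set \<Rightarrow> real^'n \<Rightarrow> bool"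
  for d :: "real^'n^'n" and p0 :: "real^'n" and k :: 'n where
  phase3_init: "J = {j. p0 $ j \<noteq> 0} \<union> {k} \<Longrightarrow> phase3 d p0 k p0 J (p_on d J)"
| phase3_step: "phase3 d p0 k p J y \<Longrightarrow> (MIN j\<in>J. y $ j) < 0 \<Longrightarrow>
    t = Min {p $ i / (p $ i - y $ i) | i. y $ i < 0} \<Longrightarrow>
    p' = p + t *\<^sub>R (y - p) \<Longrightarrow> J' = {j. p' $ j > 0} \<Longrightarrow>
    phase3 d p0 k p' J' (p_on d J')"

text \<open>The values of the variables \<open>p, g, c, k, b, q\<^sub>b\<close> at a check.\<close>

record ('n::finite) check_state =
  cur_p :: "real^'n"
  cur_g :: "real^'n"
  cur_c :: real
  cur_k :: 'n
  cur_b :: "real^'n"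
  cur_qb :: real

definition evaluated :: "real^'n^'n \<Rightarrow> 'n check_state \<Rightarrow> bool" where
  "evaluated d s \<longleftrightarrow>
     cur_g s = d *v cur_p s \<and> cur_c s = cur_p s \<bullet> cur_g s \<and> is_argmax (cur_g s) (cur_k s)"

definition init_check :: "real^'n^'n \<Rightarrow> 'n check_state \<Rightarrow> bool" where
  "init_check d s \<longleftrightarrow>
     (\<exists>J. phase1 d J (cur_p s)) \<and> \<not> (MIN j. cur_p s $ j) < 0 \<and>
     evaluated d s \<and> cur_b s = cur_p s \<and> cur_qb s = cur_c s"

definition check_holds :: "'n::finite check_state \<Rightarrow> bool" where
  "check_holds s \<longleftrightarrow> cur_g s $ cur_k s > cur_c s"

text \<open>\<open>w\<close>, \<open>qw\<close>, \<open>Gw\<close>, \<open>kw\<close> are values set by the shadow step executed from the state \<open>s\<close>.\<close>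

definition shadow_choice ::
  "real^'n^'n \<Rightarrow> 'n check_state \<Rightarrow> real^'n \<Rightarrow> real \<Rightarrow> real \<Rightarrow> 'n \<Rightarrow> bool" where
  "shadow_choice d s w qw Gw kw \<longleftrightarrow>
     (if cur_c s \<ge> cur_qb s
      then w = cur_p s \<and> qw = cur_c s \<and> Gw = 2 * (cur_g s $ cur_k s - cur_c s) \<and> kw = cur_k s
      else (let h = d *v cur_b s in
              w = cur_b s \<and> qw = cur_b s \<bullet> h \<and> Gw = 2 * ((MAX j. h $ j) - qw) \<and> is_argmax h kw))"

definition next_check :: "real^'n^'n \<Rightarrow> 'n check_state \<Rightarrow> 'n check_state \<Rightarrow> bool" where
  "next_check d s s' \<longleftrightarrow>
     check_holds s \<and>
     (\<exists>w qw Gw kw. shadow_choice d s w qw Gw kw \<and>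
        (let \<gamma> = Gw / (2 * (Gw + qw)) in cur_b s' = w + \<gamma> *\<^sub>R (axis kw 1 - w)) \<and>
        cur_qb s' = qw + Gw^2 / (4 * (Gw + qw))) \<and>
     (\<exists>p J. phase3 d (cur_p s) (cur_k s) p J (cur_p s') \<and> \<not> (MIN j\<in>J. cur_p s' $ j) < 0) \<and>
     evaluated d s'"

text \<open>\<open>S 0, \<dots>, S N\<close> are the states at the checks \<open>0, \<dots>, N\<close> of a (possibly continuing) run.\<close>

definition trajectory :: "real^'n^'n \<Rightarrow> nat \<Rightarrow> (nat \<Rightarrow> 'n check_state) \<Rightarrow> bool" where
  "trajectory d N S \<longleftrightarrow> init_check d (S 0) \<and> (\<forall>i<N. next_check d (S i) (S (Suc i)))"

definition stop_point :: "'n::finite check_state \<Rightarrow> real^'n" where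
  "stop_point s = (if cur_qb s > cur_c s then cur_b s else cur_p s)"

end

theory Submission
  imports Defs
begin

text \<open>
  On the hyperplane of vectors with sum \<open>1\<close> the form \<open>q\<close> is strictly concave, so \<open>p\<^sup>J\<close> maximises \<open>q\<close>
  among its vectors supported on \<open>J\<close>. Hence Phases I and III never leave the index sets with at
  least two elements, and \<open>p\<close> is a point of the simplex with \<open>q(p) > 0\<close> at every check.
  The rate comes from the shadow step alone. It is an exact Frank--Wolfe line search from the
  better point \<open>w\<close> of \<open>p\<close> and \<open>b\<close>, and \<open>c\<^sub>* - q(w) \<le> G\<close> by concavity, where \<open>G\<close> is the Frank--Wolfe
  gap. It therefore gains \<open>G\<^sup>2 / (4(G + q(w))) \<ge> (c\<^sub>* - q(w))\<^sup>2 / (4c\<^sub>*)\<close>. For \<open>r = 1 - q(w)/c\<^sub>*\<close> this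
  says that the next value of \<open>r\<close> is at most \<open>r - r\<^sup>2/4\<close>, so that \<open>1/r\<close> grows by at least \<open>1/4\<close>.
\<close>

section \<open>The simplex, the maximum of \<open>q\<close> on it, and elementary bounds\<close>

lemma card_ge_2_iff:
  fixes J :: "'a::finite set"
  shows "2 \<le> card J \<longleftrightarrow> (\<exists>a\<in>J. \<exists>b\<in>J. a \<noteq> b)"
  using card_le_Suc0_iff_eq[of J] by auto

lemma prob_simplex_iff:
  fixes p :: "real^'n"
  shows "p \<in> prob_simplex \<longleftrightarrow> (\<forall>i. 0 \<le> p $ i) \<and> (\<Sum>i\<in>UNIV. p $ i) = 1"
proof -
  have "p $ i \<le> (\<Sum>i\<in>UNIV. p $ i)" if "\<forall>i. 0 \<le> p $ i" for i
    by (rule member_le_sum) (use that in auto)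
  then show ?thesis
    unfolding prob_simplex_def by fastforce
qed

lemma compact_prob_simplex: "compact (prob_simplex :: (real^'n) set)"
proof -
  have "prob_simplex = cbox 0 1 \<inter> {p :: real^'n. (\<Sum>i\<in>UNIV. p $ i) = 1}"
    by (auto simp: prob_simplex_def mem_box_cart)
  moreover have "closed {p :: real^'n. (\<Sum>i\<in>UNIV. p $ i) = 1}"
    by (intro closed_Collect_eq continuous_intros)
  ultimately show ?thesis
    by (metis compact_Int_closed compact_cbox)
qed

lemma continuous_on_qform: "continuous_on S (qform d)"
  unfolding qform_def
  by (intro continuous_on_inner continuous_on_id linear_continuous_on matrix_vector_mul_bounded_linear)

lemma axis_in_prob_simplex: "axis k 1 \<in> (prob_simplex :: (real^'n) set)"
  unfolding prob_simplex_iff by (simp add: axis_def)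

lemma convex_prob_simplex: "convex (prob_simplex :: (real^'n) set)"
  unfolding convex_def Ball_def prob_simplex_iff
  by (auto simp: sum.distrib sum_distrib_left[symmetric])

text \<open>\<open>GREATEST\<close> is meaningful only if a maximum exists; compactness of the
  simplex and continuity of \<open>q\<close> supply one.\<close>

lemma c_star_attained:
  fixes d :: "real^'n^'n"
  obtains p where "p \<in> prob_simplex" "c_star d = qform d p"
    "\<And>x. x \<in> prob_simplex \<Longrightarrow> qform d x \<le> qform d p"
proof -
  obtain p where p: "p \<in> prob_simplex" "\<And>x. x \<in> prob_simplex \<Longrightarrow> qform d x \<le> qform d p"
    using continuous_attains_sup[OF compact_prob_simplex _ continuous_on_qform[of _ d]]
      axis_in_prob_simplex by blast
  have "c_star d = qform d p"
    unfolding c_star_def by (rule Greatest_equality) (use p in auto)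
  with p that show ?thesis by blast
qed

lemma qform_le_c_star: "x \<in> prob_simplex \<Longrightarrow> qform d x \<le> c_star d"
  by (metis c_star_attained)

lemma qform_sum: "qform d x = (\<Sum>i\<in>UNIV. \<Sum>j\<in>UNIV. d $ i $ j * x $ i * x $ j)"
  by (simp add: qform_def inner_vec_def matrix_vector_mult_def sum_distrib_left mult_ac)

text \<open>The products \<open>p $ i * p $ j\<close> are nonnegative weights with total 1, so
  \<open>q(p)\<close> is a weighted mean of the entries of \<open>d\<close>.\<close>

lemma c_star_le_d_max: "c_star d \<le> d_max d"
proof -
  obtain p where p: "p \<in> prob_simplex" "c_star d = qform d p"
    by (rule c_star_attained)
  have p0: "0 \<le> p $ i" and p1: "(\<Sum>i\<in>UNIV. p $ i) = 1" for i
    using p(1) by (auto simp: prob_simplex_iff)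
  have "d $ i $ j \<le> d_max d" for i j
    unfolding d_max_def by (rule Max_ge) (auto intro: rev_image_eqI[of "(i, j)"])
  then have "qform d p \<le> (\<Sum>i\<in>UNIV. \<Sum>j\<in>UNIV. d_max d * p $ i * p $ j)"
    unfolding qform_sum by (intro sum_mono mult_right_mono p0)
  also have "\<dots> = d_max d * ((\<Sum>i\<in>UNIV. p $ i) * (\<Sum>j\<in>UNIV. p $ j))"
    by (simp add: sum_product sum_distrib_left mult_ac)
  finally show ?thesis
    using p(2) p1 by simp
qed

lemma inner_le_of_le_on_simplex:
  fixes x h :: "real^'n"
  assumes "x \<in> prob_simplex" and "\<And>j. h $ j \<le> m"
  shows "x \<bullet> h \<le> m"
proof -
  have "x \<bullet> h \<le> (\<Sum>i\<in>UNIV. x $ i * m)"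
    unfolding inner_vec_def
    by (simp, intro sum_mono mult_left_mono) (use assms in \<open>auto simp: prob_simplex_iff\<close>)
  then show ?thesis
    using assms(1) by (simp add: prob_simplex_iff flip: sum_distrib_right)
qed

text \<open>Applied to vectors \<open>h = d *v p\<close> that are constant on \<open>J\<close>:
  pairing with a vector supported on \<open>J\<close> then only sees its coordinate sum.\<close>

lemma inner_const_on:
  fixes x h :: "real^'n"
  assumes "\<And>i. i \<notin> J \<Longrightarrow> x $ i = 0" and "\<And>i. i \<in> J \<Longrightarrow> h $ i = l"
  shows "x \<bullet> h = l * (\<Sum>i\<in>UNIV. x $ i)"
proof -
  have "x $ i * h $ i = l * x $ i" for i
    using assms by (cases "i \<in> J") auto
  then show ?thesis
    by (simp only: inner_vec_def inner_real_def sum_distrib_left)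
qed

lemma is_argmax_Max: "is_argmax g k \<Longrightarrow> (MAX j. g $ j) = g $ k"
  unfolding is_argmax_def by (intro Max_eqI) auto

subsection \<open>Principal submatrices\<close>

text \<open>\<open>principal (mat 1) J\<close> is the coordinate projection onto \<open>J\<close>:
  on the left it clears rows outside \<open>J\<close>, on the right columns.\<close>

lemma principal_unit_mult:
  fixes A :: "real^'n^'n"
  shows "principal (mat 1) J ** A = (\<chi> i j. if i \<in> J then A $ i $ j else 0)"
    and "A ** principal (mat 1) J = (\<chi> i j. if j \<in> J then A $ i $ j else 0)"
proof -
  have "(principal (mat 1) J ** A) $ i $ j
      = (\<Sum>k\<in>UNIV. if k = i then (if i \<in> J then A $ i $ j else 0) else 0)" for i j
    unfolding matrix_matrix_mult_def principal_def mat_def vec_lambda_beta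
    by (intro sum.cong) auto
  then show "principal (mat 1) J ** A = (\<chi> i j. if i \<in> J then A $ i $ j else 0)"
    by (simp add: vec_eq_iff)
  have "(A ** principal (mat 1) J) $ i $ j
      = (\<Sum>k\<in>UNIV. if k = j then (if j \<in> J then A $ i $ j else 0) else 0)" for i j
    unfolding matrix_matrix_mult_def principal_def mat_def vec_lambda_beta
    by (intro sum.cong) auto
  then show "A ** principal (mat 1) J = (\<chi> i j. if j \<in> J then A $ i $ j else 0)"
    by (simp add: vec_eq_iff)
qed

lemma principal_vec_mult:
  assumes "\<And>j. j \<notin> J \<Longrightarrow> x $ j = 0"
  shows "(principal A J *v x) $ i = (if i \<in> J then (A *v x) $ i else 0)"
proof -
  have "(\<Sum>j\<in>UNIV. (if i \<in> J \<and> j \<in> J then A $ i $ j else 0) * x $ j)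
      = (\<Sum>j\<in>UNIV. if i \<in> J then A $ i $ j * x $ j else 0)"
    using assms by (intro sum.cong) auto
  then show ?thesis
    by (simp add: matrix_vector_mult_def principal_def)
qed

text \<open>The block on \<open>J\<close> is completed to a full matrix \<open>M\<close> by the
  identity on the complement. The kernel hypothesis makes \<open>M\<close> invertible. Its inverse
  \<open>C\<close> commutes with the projection \<open>E\<close> onto \<open>J\<close> because
  \<open>M\<close> does, and \<open>C ** E\<close> is the inverse sought.\<close>

lemma exists_principal_inv:
  fixes A :: "real^'n^'n"
  assumes ker: "\<And>v. (\<And>i. i \<notin> J \<Longrightarrow> v $ i = 0) \<Longrightarrow> (\<And>i. i \<in> J \<Longrightarrow> (A *v v) $ i = 0) \<Longrightarrow> v = 0"
  shows "\<exists>B. principal B J = B \<and> principal A J ** B = principal (mat 1) J \<and>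
           B ** principal A J = principal (mat 1) J"
proof -
  define E where "E = principal (mat 1 :: real^'n^'n) J"
  \<comment> \<open>the block diagonal matrix with blocks \<open>A\<^sub>J\<^sub>J\<close> and \<open>1\<close>\<close>
  define M where "M = (\<chi> i j. if i \<in> J then if j \<in> J then A $ i $ j else 0
                        else if i = j then 1 else 0)"
  have EM: "principal A J = E ** M" and ME: "principal A J = M ** E"
    unfolding E_def principal_unit_mult by (auto simp: vec_eq_iff principal_def M_def)
  have EE: "E ** E = E"
    unfolding E_def principal_unit_mult by (auto simp: vec_eq_iff principal_def)
  have pr: "principal B J = E ** (B ** E)" for B
    unfolding E_def principal_unit_mult by (auto simp: vec_eq_iff principal_def)
  \<comment> \<open>Rows of \<open>M\<close> outside \<open>J\<close> force \<open>v\<close> to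
    vanish there; the rows in \<open>J\<close> then say that \<open>A *v v\<close> vanishes on
    \<open>J\<close>, so \<open>ker\<close> applies.\<close>
  have "v = 0" if "M *v v = 0" for v
  proof (rule ker)
    have Mv: "(\<Sum>j\<in>UNIV. M $ i $ j * v $ j) = 0" for i
      using that by (simp add: vec_eq_iff matrix_vector_mult_def)
    show off: "v $ i = 0" if "i \<notin> J" for i
    proof -
      have "(\<Sum>j\<in>UNIV. M $ i $ j * v $ j) = (\<Sum>j\<in>UNIV. if j = i then v $ i else 0)"
        using that by (intro sum.cong) (auto simp: M_def)
      with Mv show ?thesis by simp
    qed
    show "(A *v v) $ i = 0" if "i \<in> J" for i
    proof -
      have "(\<Sum>j\<in>UNIV. A $ i $ j * v $ j) = (\<Sum>j\<in>UNIV. M $ i $ j * v $ j)"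
        using that off by (intro sum.cong) (auto simp: M_def)
      with Mv show ?thesis by (simp add: matrix_vector_mult_def)
    qed
  qed
  then obtain C where CM: "C ** M = mat 1"
    using matrix_left_invertible_ker[of M] by blast
  then have MC: "M ** C = mat 1"
    by (simp add: matrix_left_right_inverse)
  \<comment> \<open>Multiplying \<open>M ** E = E ** M\<close> by \<open>C\<close> on both sides
    transfers the commutation to the inverse.\<close>
  have "C ** (M ** E) ** C = C ** (E ** M) ** C"
    using EM ME by simp
  then have "(C ** M) ** E ** C = C ** E ** (M ** C)"
    by (simp add: matrix_mul_assoc)
  then have EC: "E ** C = C ** E"
    by (simp add: CM MC)
  have "E ** (C ** E ** E) = (C ** E) ** E ** E"
    by (metis EC matrix_mul_assoc)
  then have "E ** (C ** E ** E) = C ** E"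
    by (metis EE matrix_mul_assoc)
  moreover have "E ** M ** (C ** E) = E"
    by (metis EE MC matrix_mul_assoc matrix_mul_rid)
  moreover have "C ** E ** (M ** E) = E"
    by (metis EE CM EM ME matrix_mul_assoc matrix_mul_lid)
  ultimately show ?thesis
    using EM ME pr unfolding E_def[symmetric] by metis
qed

subsection \<open>Matrices of strict negative type\<close>

locale negative_type_matrix =
  fixes d :: "real^'n^'n"
  assumes sym: "d $ i $ j = d $ j $ i"
    and diag: "d $ i $ i = 0"
    and pos: "i \<noteq> j \<Longrightarrow> d $ i $ j > 0"
    and neg: "strict_negative_type d"
begin

lemma inner_swap: "x \<bullet> (d *v y) = y \<bullet> (d *v x)"
proof -
  have "transpose d = d"
    by (simp add: vec_eq_iff transpose_def sym)
  then show ?thesis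
    by (metis dot_lmul_matrix inner_commute transpose_matrix_vector)
qed

lemma qform_add: "qform d (x + u) = qform d x + 2 * (u \<bullet> (d *v x)) + qform d u"
  using inner_swap[of x u]
  by (simp add: qform_def matrix_vector_right_distrib inner_add_left inner_add_right)

lemma qform_scaleR: "qform d (a *\<^sub>R x) = a\<^sup>2 * qform d x"
  by (simp add: qform_def matrix_vector_mult_scaleR power2_eq_square)

lemma qform_neg: "v \<noteq> 0 \<Longrightarrow> (\<Sum>i\<in>UNIV. v $ i) = 0 \<Longrightarrow> qform d v < 0"
  using neg by (simp add: strict_negative_type_def qform_def)

lemma qform_nonpos: "(\<Sum>i\<in>UNIV. v $ i) = 0 \<Longrightarrow> qform d v \<le> 0"
  using qform_neg[of v] by (cases "v = 0") (auto simp: qform_def)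

text \<open>Concavity on a hyperplane of constant coordinate sum: the second-order term is
  \<open>q\<close> of a vector with sum 0, hence nonpositive.\<close>

lemma qform_le_tangent:
  assumes "(\<Sum>i\<in>UNIV. x $ i) = (\<Sum>i\<in>UNIV. p $ i)"
  shows "qform d x \<le> qform d p + 2 * ((x - p) \<bullet> (d *v p))"
proof -
  have "qform d (x - p) \<le> 0"
    using assms by (intro qform_nonpos) (simp add: sum_subtractf)
  then show ?thesis
    using qform_add[of p "x - p"] by simp
qed

text \<open>The gradient at \<open>p\<close> is constant on \<open>J\<close>, so the linear term of
  the tangent bound vanishes and only \<open>q(p) = l\<close> remains.\<close>

lemma qform_le_critical:
  assumes "\<And>i. i \<notin> J \<Longrightarrow> p $ i = 0" "(\<Sum>i\<in>UNIV. p $ i) = 1" "\<And>i. i \<in> J \<Longrightarrow> (d *v p) $ i = l"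
    and "\<And>i. i \<notin> J \<Longrightarrow> x $ i = 0" "(\<Sum>i\<in>UNIV. x $ i) = 1"
  shows "qform d x \<le> l"
proof -
  have "p \<bullet> (d *v p) = l" "x \<bullet> (d *v p) = l"
    using inner_const_on[of J p "d *v p" l] inner_const_on[of J x "d *v p" l] assms by auto
  then show ?thesis
    using qform_le_tangent[of x p] assms by (simp add: inner_diff_left qform_def)
qed

text \<open>The midpoint of two vertices \<open>a\<close>, \<open>b\<close> in \<open>J\<close> has
  the value \<open>d $ a $ b / 2\<close>.\<close>

lemma positive_point:
  assumes "2 \<le> card J"
  obtains x where "x \<in> prob_simplex" "\<And>i. i \<notin> J \<Longrightarrow> x $ i = 0" "qform d x > 0"
proof -
  obtain a b where ab: "a \<in> J" "b \<in> J" "a \<noteq> b"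
    using assms card_ge_2_iff by metis
  let ?a = "axis a 1 :: real^'n" and ?b = "axis b 1 :: real^'n"
  let ?x = "(1/2) *\<^sub>R ?a + (1/2) *\<^sub>R ?b"
  have "?x \<in> prob_simplex"
    by (intro convexD[OF convex_prob_simplex] axis_in_prob_simplex) auto
  moreover have "?x $ i = 0" if "i \<notin> J" for i
    using that ab by (auto simp: axis_def)
  moreover have "qform d ?x > 0"
    using pos[OF ab(3)] pos[OF ab(3)[symmetric]]
    by (simp add: qform_add qform_scaleR)
      (simp add: qform_def matrix_vector_mult_scaleR matrix_vector_mult_basis column_def
        inner_axis' diag)
  ultimately show ?thesis
    using that by blast
qed

text \<open>A nonzero kernel vector has \<open>q(v) = 0\<close>, so by strict negativity its sum is
  nonzero. Scaled to sum 1 it is critical with value 0, which contradicts the existence of a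
  positive value on \<open>J\<close>.\<close>

lemma kernel_trivial:
  assumes J: "2 \<le> card J"
    and off: "\<And>i. i \<notin> J \<Longrightarrow> v $ i = 0" and on: "\<And>i. i \<in> J \<Longrightarrow> (d *v v) $ i = 0"
  shows "v = 0"
proof (rule ccontr)
  assume "v \<noteq> 0"
  define s where "s = (\<Sum>i\<in>UNIV. v $ i)"
  have "qform d v = 0"
    using inner_const_on[of J v "d *v v" 0] off on by (simp add: qform_def)
  with \<open>v \<noteq> 0\<close> have "s \<noteq> 0"
    using qform_neg[of v] by (auto simp: s_def)
  obtain x where x: "x \<in> prob_simplex" "\<And>i. i \<notin> J \<Longrightarrow> x $ i = 0" "qform d x > 0"
    using positive_point[OF J] by metis
  have "qform d x \<le> 0"
  proof (rule qform_le_critical[where J = J])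
    show "(\<Sum>i\<in>UNIV. ((1/s) *\<^sub>R v) $ i) = 1"
      using \<open>s \<noteq> 0\<close> by (simp add: s_def flip: sum_divide_distrib)
  qed (use x off on in \<open>auto simp: prob_simplex_iff matrix_vector_mult_scaleR\<close>)
  with x(3) show False by simp
qed

text \<open>The vector \<open>w_on d J\<close> solves \<open>d w = 1\<close> on \<open>J\<close>, so
  \<open>p_on d J\<close> is critical with value \<open>1/s\<close>, where \<open>s\<close> is the
  sum of \<open>w\<close>. Maximality follows from concavity, and positivity by comparison with a
  midpoint of two vertices.\<close>

lemma p_on_props:
  assumes J: "2 \<le> card J"
  shows "\<And>i. i \<notin> J \<Longrightarrow> p_on d J $ i = 0"
    and "(\<Sum>i\<in>UNIV. p_on d J $ i) = 1"
    and "\<And>i. i \<in> J \<Longrightarrow> (d *v p_on d J) $ i = qform d (p_on d J)"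
    and "\<And>x. (\<And>i. i \<notin> J \<Longrightarrow> x $ i = 0) \<Longrightarrow> (\<Sum>i\<in>UNIV. x $ i) = 1 \<Longrightarrow>
           qform d x \<le> qform d (p_on d J)"
    and "qform d (p_on d J) > 0"
proof -
  define B where "B = principal_inv d J"
  \<comment> \<open>Triviality of the kernel provides an inverse, so the \<open>SOME\<close> in
    \<open>principal_inv\<close> picks a genuine one.\<close>
  have B: "principal B J = B" "principal d J ** B = principal (mat 1) J"
    using someI_ex[OF exists_principal_inv, OF kernel_trivial[OF J], of J]
    unfolding B_def principal_inv_def by auto
  define w where "w = w_on d J"
  define s where "s = (\<Sum>i\<in>UNIV. w $ i)"
  have w: "w = B *v ones_on J"
    by (simp add: w_def w_on_def B_def)
  have w_off: "w $ i = 0" if "i \<notin> J" for i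
  proof -
    have "w = principal B J *v ones_on J"
      using B(1) w by simp
    then show ?thesis
      using that by (simp add: principal_vec_mult ones_on_def)
  qed
  have "principal d J *v w = principal (mat 1) J *v ones_on J"
    using B(2) by (simp add: w matrix_vector_mul_assoc)
  then have dw: "(d *v w) $ i = 1" if "i \<in> J" for i
    using that principal_vec_mult[of J w d i] w_off
      principal_vec_mult[of J "ones_on J" "mat 1" i]
    by (simp add: ones_on_def)
  have "w \<noteq> 0"
  proof
    assume "w = 0"
    moreover obtain i where "i \<in> J"
      using J by (force simp: card_ge_2_iff)
    ultimately show False
      using dw[of i] by simp
  qed
  \<comment> \<open>If \<open>s\<close> were 0, \<open>w\<close> would be a nonzero vector with sum
    0 and \<open>q(w) = 0\<close>, against strict negative type.\<close>
  moreover have "qform d w = s"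
    using inner_const_on[of J w "d *v w" 1] w_off dw by (simp add: qform_def s_def)
  ultimately have "s \<noteq> 0"
    using qform_neg[of w] by (auto simp: s_def)
  have "ones_on J \<bullet> w = s"
    using inner_const_on[of J w "ones_on J" 1] w_off
    by (simp add: inner_commute ones_on_def s_def)
  then have p: "p_on d J = (1/s) *\<^sub>R w"
    by (simp add: p_on_def w_def)
  show off: "p_on d J $ i = 0" if "i \<notin> J" for i
    using that w_off p by simp
  show sum: "(\<Sum>i\<in>UNIV. p_on d J $ i) = 1"
    using p \<open>s \<noteq> 0\<close> by (simp add: s_def flip: sum_divide_distrib)
  have on: "(d *v p_on d J) $ i = 1/s" if "i \<in> J" for i
    using dw[OF that] p by (simp add: matrix_vector_mult_scaleR)
  have val: "qform d (p_on d J) = 1/s"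
    using inner_const_on[of J "p_on d J" "d *v p_on d J" "1/s"] off on sum by (simp add: qform_def)
  show "(d *v p_on d J) $ i = qform d (p_on d J)" if "i \<in> J" for i
    using on[OF that] val by simp
  show max: "qform d x \<le> qform d (p_on d J)"
    if "\<And>i. i \<notin> J \<Longrightarrow> x $ i = 0" "(\<Sum>i\<in>UNIV. x $ i) = 1" for x
    unfolding val by (rule qform_le_critical[where J = J and p = "p_on d J"]) (use off sum on that in auto)
  obtain x where "x \<in> prob_simplex" "\<And>i. i \<notin> J \<Longrightarrow> x $ i = 0" "qform d x > 0"
    using positive_point[OF J] by metis
  then show "qform d (p_on d J) > 0"
    using max[of x] by (force simp: prob_simplex_iff)
qed

text \<open>With a zero diagonal, only pairs of distinct support indices contribute to
  \<open>q\<close>. A positive value thus rules out degenerate index sets.\<close>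

lemma card_support_ge_2:
  assumes "qform d p > 0" and "\<And>i. i \<notin> J \<Longrightarrow> p $ i = 0"
  shows "2 \<le> card J"
proof (rule ccontr)
  assume "\<not> 2 \<le> card J"
  then have zero: "d $ i $ j * p $ i * p $ j = 0" for i j
    unfolding card_ge_2_iff using assms(2) diag by (metis mult_zero_left mult_zero_right)
  have "qform d p = 0"
    by (simp only: qform_sum zero sum.neutral_const)
  with assms(1) show False by simp
qed

subsection \<open>Invariants of the algorithm\<close>

text \<open>If \<open>j\<close> were the only positive coordinate of \<open>p\<close>, row
  \<open>j\<close> would give \<open>(d *v p) $ j \<le> 0\<close>, since
  \<open>d $ j $ j = 0\<close>. But on \<open>J\<close> this entry equals
  \<open>q(p) > 0\<close>.\<close>

lemma phase1_card:
  assumes "phase1 d J p" and "2 \<le> CARD('n)"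
  shows "2 \<le> card J \<and> p = p_on d J"
  using assms
proof (induction rule: phase1.induct)
  case (phase1_step J p J')
  then have J: "2 \<le> card J" and p: "p = p_on d J"
    by auto
  note P = p_on_props[OF J, folded p]
  have "\<exists>j. p $ j > 0"
  proof (rule ccontr)
    assume "\<not> (\<exists>j. p $ j > 0)"
    then have "(\<Sum>i\<in>UNIV. p $ i) \<le> 0"
      by (intro sum_nonpos) (simp add: not_less)
    with P(2) show False by simp
  qed
  then obtain j where j: "p $ j > 0" by blast
  have "2 \<le> card J'"
  proof (rule ccontr)
    assume "\<not> 2 \<le> card J'"
    then have np: "p $ i \<le> 0" if "i \<noteq> j" for i
      using j that unfolding card_ge_2_iff phase1_step.hyps(3) by (metis mem_Collect_eq not_less)
    have "d $ j $ i * p $ i \<le> 0" for i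
      using np[of i] pos[of j i] diag[of j]
      by (cases "i = j") (auto simp: mult_nonneg_nonpos)
    then have "(d *v p) $ j \<le> 0"
      by (simp add: matrix_vector_mult_def sum_nonpos)
    moreover have "j \<in> J"
      using P(1)[of j] j by force
    ultimately show False
      using P(3)[of j] P(5) by simp
  qed
  then show ?case by simp
qed simp

text \<open>The step \<open>t\<close> is the largest that keeps all coordinates nonnegative. Since
  \<open>p\<close> is supported on \<open>J\<close>, moving towards the maximiser \<open>y\<close>
  does not decrease \<open>q\<close>, so \<open>q(p)\<close> stays positive, and this keeps at least
  two indices in \<open>J\<close>.\<close>

lemma phase3_invariant:
  assumes "phase3 d p0 k p J y" and "p0 \<in> prob_simplex" and "qform d p0 > 0"
  shows "p \<in> prob_simplex \<and> qform d p > 0 \<and> (\<forall>i. i \<notin> J \<longrightarrow> p $ i = 0) \<and> y = p_on d J"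
  using assms
proof (induction rule: phase3.induct)
  case (phase3_step p J y t p' J')
  then have p: "p \<in> prob_simplex" "qform d p > 0" and off: "\<And>i. i \<notin> J \<Longrightarrow> p $ i = 0"
    and y: "y = p_on d J"
    by auto
  have J: "2 \<le> card J"
    using card_support_ge_2 p off by blast
  note Y = p_on_props[OF J, folded y]
  have p0: "p $ i \<ge> 0" and p1: "(\<Sum>i\<in>UNIV. p $ i) = 1" for i
    using p by (auto simp: prob_simplex_iff)
  let ?T = "{p $ i / (p $ i - y $ i) | i. y $ i < 0}"
  have T: "finite ?T" by simp
  have "J \<noteq> {}" using J by auto
  then obtain j where "y $ j < 0"
    using phase3_step.hyps(2) by (auto simp: Min_less_iff)
  then have "?T \<noteq> {}" by auto
  \<comment> \<open>The minimum is attained at some \<open>i\<close> with \<open>y $ i < 0\<close>;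
    the ratio there lies between 0 and 1 because \<open>p $ i\<close> is nonnegative.\<close>
  then have "t \<in> ?T"
    using Min_in[OF T] phase3_step.hyps(3) by simp
  then obtain i where i: "y $ i < 0" "t = p $ i / (p $ i - y $ i)"
    by auto
  have t: "0 \<le> t" "t \<le> 1"
    unfolding i(2) using i(1) p0[of i] by (auto intro!: divide_nonneg_nonneg simp: divide_le_eq_1)
  have p': "p' = (1 - t) *\<^sub>R p + t *\<^sub>R y"
    using phase3_step.hyps(4) by (simp add: algebra_simps)
  have "p' $ i \<ge> 0" for i
  proof (cases "y $ i < 0")
    case True
    then have "t \<le> p $ i / (p $ i - y $ i)"
      unfolding phase3_step.hyps(3) by (intro Min_le T) auto
    then have "t * (p $ i - y $ i) \<le> p $ i"
      using True p0[of i] by (simp add: pos_le_divide_eq)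
    then show ?thesis
      by (simp add: p' algebra_simps)
  next
    case False
    then show ?thesis
      using p0[of i] t by (simp add: p')
  qed
  moreover have "(\<Sum>i\<in>UNIV. p' $ i) = 1"
    using p1 Y(2) by (simp add: p' sum.distrib flip: sum_distrib_left)
  ultimately have p'_simplex: "p' \<in> prob_simplex"
    by (simp add: prob_simplex_iff)
  have "qform d p' > 0"
  proof -
    \<comment> \<open>\<open>q\<close> is concave on the segment from \<open>p\<close> to \<open>y\<close>, and \<open>q(y) \<ge> q(p)\<close>\<close>
    have yy: "qform d y = qform d p + 2 * ((y - p) \<bullet> (d *v p)) + qform d (y - p)"
      using qform_add[of p "y - p"] by simp
    have pp: "qform d p' = qform d p + 2 * t * ((y - p) \<bullet> (d *v p)) + t\<^sup>2 * qform d (y - p)"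
      using qform_add[of p "t *\<^sub>R (y - p)"] phase3_step.hyps(4) by (simp add: qform_scaleR)
    have "qform d (y - p) \<le> 0"
      using Y(2) p1 by (intro qform_nonpos) (simp add: sum_subtractf)
    moreover have "t\<^sup>2 \<le> t"
      using t by (simp add: power2_eq_square mult_left_le)
    ultimately have "t * qform d (y - p) \<le> t\<^sup>2 * qform d (y - p)"
      by (intro mult_right_mono_neg)
    moreover have "t * (qform d y - qform d p) \<ge> 0"
      using t Y(4)[of p] off p1 by simp
    ultimately show ?thesis
      using p(2) yy pp by (simp add: algebra_simps)
  qed
  moreover have "\<forall>i. i \<notin> J' \<longrightarrow> p' $ i = 0"
    unfolding phase3_step.hyps(5) using p'_simplex
    by (metis mem_Collect_eq order_le_less prob_simplex_iff)
  ultimately show ?case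
    using p'_simplex by blast
qed auto

lemma nonneg_p_on_in_simplex:
  assumes "2 \<le> card J" and "\<not> (MIN j\<in>J. p_on d J $ j) < 0"
  shows "p_on d J \<in> prob_simplex" "qform d (p_on d J) > 0"
proof -
  note P = p_on_props[OF assms(1)]
  have "p_on d J $ j \<ge> 0" for j
  proof (cases "j \<in> J")
    case True
    have "(MIN j\<in>J. p_on d J $ j) \<le> p_on d J $ j"
      by (rule Min_le) (use True in auto)
    with assms(2) show ?thesis by linarith
  qed (use P(1) in auto)
  then show "p_on d J \<in> prob_simplex"
    using P(2) by (simp add: prob_simplex_iff)
  show "qform d (p_on d J) > 0" by (rule P(5))
qed

text \<open>The invariant at checks. The recorded \<open>c\<close> and \<open>q\<^sub>b\<close> are
  true values of \<open>q\<close>, and positivity of \<open>c\<close> keeps the denominators of the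
  shadow step positive.\<close>

definition good_state :: "'n check_state \<Rightarrow> bool" where
  "good_state s \<longleftrightarrow>
     cur_p s \<in> prob_simplex \<and> cur_c s > 0 \<and> cur_c s = qform d (cur_p s) \<and>
     cur_b s \<in> prob_simplex \<and> cur_qb s = qform d (cur_b s) \<and> evaluated d s"

text \<open>Initially \<open>q\<^sub>b = c\<close>, and the strict comparison in
  \<open>stop_point\<close> resolves this tie to \<open>p\<close>.\<close>

lemma init_check_good:
  assumes "init_check d s" and "2 \<le> CARD('n)"
  shows "good_state s" "stop_point s = cur_p s"
proof -
  obtain J where J: "phase1 d J (cur_p s)"
    using assms(1) by (auto simp: init_check_def)
  have nonneg: "cur_p s $ j \<ge> 0" for j
  proof -
    have "(MIN j. cur_p s $ j) \<le> cur_p s $ j"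
      by (rule Min_le) auto
    moreover have "\<not> (MIN j. cur_p s $ j) < 0"
      using assms(1) by (simp add: init_check_def)
    ultimately show ?thesis by linarith
  qed
  have "2 \<le> card J" "cur_p s = p_on d J"
    using phase1_card[OF J assms(2)] by auto
  then have "cur_p s \<in> prob_simplex" "qform d (cur_p s) > 0"
    using nonneg p_on_props(2,5)[of J] by (auto simp: prob_simplex_iff)
  then show "good_state s" "stop_point s = cur_p s"
    using assms(1) by (auto simp: good_state_def init_check_def evaluated_def qform_def stop_point_def)
qed

section \<open>The stop point and the Frank--Wolfe step taken from it\<close>

lemma stop_point_good:
  assumes "good_state s"
  shows "stop_point s \<in> prob_simplex"
    and "qform d (stop_point s) = max (cur_c s) (cur_qb s)"
    and "0 < qform d (stop_point s)"
  using assms by (auto simp: good_state_def stop_point_def)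

text \<open>The tests \<open>c \<ge> q\<^sub>b\<close> and \<open>q\<^sub>b > c\<close> are
  complementary, so the shadow step always starts from the stop point; both branches compute the
  same gap formula.\<close>

lemma shadow_choice_props:
  assumes s: "good_state s" and ch: "shadow_choice d s w qw G k"
  shows "w = stop_point s" "qw = qform d w" "G = 2 * ((d *v w) $ k - qw)"
    and "is_argmax (d *v w) k"
  using assms
  by (auto simp: good_state_def stop_point_def evaluated_def shadow_choice_def Let_def qform_def
      is_argmax_Max split: if_splits)

text \<open>The tangent bound at \<open>w\<close> is evaluated at a maximiser of \<open>q\<close>;
  on the simplex the linear form \<open>d *v w\<close> is at most its largest coordinate, attained
  at \<open>k\<close>.\<close>

lemma gap:
  assumes s: "good_state s" and ch: "shadow_choice d s w qw G k"
  shows "c_star d \<le> qw + G"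
proof -
  note C = shadow_choice_props[OF assms]
  have w: "w \<in> prob_simplex"
    using stop_point_good(1)[OF s] C(1) by simp
  obtain x where x: "x \<in> prob_simplex" "c_star d = qform d x"
    by (rule c_star_attained)
  have "x \<bullet> (d *v w) \<le> (d *v w) $ k"
    using inner_le_of_le_on_simplex[OF x(1)] C(4) by (simp add: is_argmax_def)
  moreover have "qform d x \<le> qform d w + 2 * ((x - w) \<bullet> (d *v w))"
    using x(1) w by (intro qform_le_tangent) (simp add: prob_simplex_iff)
  ultimately show ?thesis
    using C(2,3) x(2) by (simp add: inner_diff_left qform_def)
qed

text \<open>Along \<open>u = axis k 1 - w\<close>, the value is
  \<open>q + g * G - g\<^sup>2 * (G + q)\<close>, a parabola in \<open>g\<close> whose vertex is the
  chosen step length.\<close>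

lemma line_search:
  assumes "qform d w > 0" and G: "G = 2 * ((d *v w) $ k - qform d w)" "G \<ge> 0"
  shows "qform d (w + (G / (2 * (G + qform d w))) *\<^sub>R (axis k 1 - w))
    = qform d w + G\<^sup>2 / (4 * (G + qform d w))"
proof -
  let ?q = "qform d w" and ?u = "axis k 1 - w :: real^'n"
  have uw: "?u \<bullet> (d *v w) = G / 2"
    using G(1) by (simp add: inner_diff_left inner_axis' qform_def)
  \<comment> \<open>The zero diagonal fixes the curvature: expanding \<open>q\<close> at the vertex
    \<open>w + u\<close> gives \<open>q(u) = -(G + q)\<close>.\<close>
  have "qform d (axis k 1) = 0"
    by (simp add: qform_def matrix_vector_mult_basis column_def inner_axis' diag)
  then have "qform d ?u = - (G + ?q)"
    using qform_add[of w ?u] uw by simp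
  then have "qform d (w + g *\<^sub>R ?u) = ?q + g * G - g\<^sup>2 * (G + ?q)" for g
    by (simp add: qform_add qform_scaleR uw del: minus_add_distrib)
  moreover have "G / (2 * D) * G - (G / (2 * D))\<^sup>2 * D = G\<^sup>2 / (4 * D)" if "D > 0" for D :: real
    using that by (simp add: field_simps power2_eq_square)
  ultimately show ?thesis
    using assms(1) G(2) by (simp only: add_diff_eq[symmetric] add_nonneg_pos)
qed

text \<open>The line search gain grows with \<open>G\<close>, and \<open>G\<close> is at least
  \<open>c_star d - q\<close>; at equality its denominator is \<open>4 * c_star d\<close>. The next
  stop point is at least as good as the new shadow.\<close>

lemma next_check_step:
  assumes s: "good_state s" and step: "next_check d s s'"
  defines "q \<equiv> qform d (stop_point s)"
  shows "good_state s'"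
    and "q + (c_star d - q)\<^sup>2 / (4 * c_star d) \<le> qform d (stop_point s')"
proof -
  obtain w qw G k where ch: "shadow_choice d s w qw G k"
    and b: "cur_b s' = w + (G / (2 * (G + qw))) *\<^sub>R (axis k 1 - w)"
    and qb: "cur_qb s' = qw + G\<^sup>2 / (4 * (G + qw))"
    using step by (auto simp: next_check_def Let_def)
  note C = shadow_choice_props[OF s ch] and S = stop_point_good[OF s] and gap = gap[OF s ch]
  have q: "qw = q" "q > 0" "q \<le> c_star d" "w \<in> prob_simplex"
    using C(1,2) S(1,3) qform_le_c_star[OF S(1), of d] by (simp_all add: q_def)
  have G: "G \<ge> c_star d - q" "G \<ge> 0"
    using gap q by auto
  let ?g = "G / (2 * (G + q))"
  have g: "0 \<le> ?g" "?g \<le> 1"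
    using G q by (auto simp: divide_simps)
  have "cur_b s' = (1 - ?g) *\<^sub>R w + ?g *\<^sub>R axis k 1"
    using b q(1) by (simp add: algebra_simps)
  then have "cur_b s' \<in> prob_simplex"
    using convexD[OF convex_prob_simplex q(4) axis_in_prob_simplex, of "1 - ?g" ?g k] g by simp
  moreover have "cur_qb s' = qform d (cur_b s')"
    using line_search[of w G k] C q G unfolding b qb by simp
  moreover obtain p J where ph: "phase3 d (cur_p s) (cur_k s) p J (cur_p s')"
    and exit: "\<not> (MIN j\<in>J. cur_p s' $ j) < 0"
    using step by (auto simp: next_check_def)
  have "cur_p s \<in> prob_simplex" "qform d (cur_p s) > 0"
    using s by (auto simp: good_state_def)
  note I = phase3_invariant[OF ph this]
  then have "2 \<le> card J"
    using card_support_ge_2 by blast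
  then have "cur_p s' \<in> prob_simplex" "qform d (cur_p s') > 0"
    using nonneg_p_on_in_simplex[of J] I exit by auto
  ultimately show good: "good_state s'"
    using step by (auto simp: good_state_def next_check_def evaluated_def qform_def)
  have "(c_star d - q)\<^sup>2 / (4 * c_star d) \<le> G\<^sup>2 / (4 * (G + q))"
  proof -
    define e where "e = c_star d - q"
    have e: "0 \<le> e" "e \<le> G" "c_star d = e + q"
      using q G by (auto simp: e_def)
    have "e * e \<le> G * G"
      using e by (intro mult_mono) auto
    then have "e * e * q \<le> G * G * q"
      using q(2) by (simp add: mult_right_mono)
    moreover have "e * G * e \<le> e * G * G"
      using e by (intro mult_left_mono) auto
    \<comment> \<open>Cross-multiplied form of the monotonicity of
      \<open>x\<^sup>2 / (x + q)\<close> for nonnegative \<open>x\<close>.\<close>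
    ultimately have "e\<^sup>2 * (G + q) \<le> G\<^sup>2 * (e + q)"
      by (simp add: power2_eq_square algebra_simps)
    then have "e\<^sup>2 / (4 * (e + q)) \<le> G\<^sup>2 / (4 * (G + q))"
      using e q(2) by (simp add: divide_simps) (simp add: algebra_simps)
    then have "e\<^sup>2 / (4 * c_star d) \<le> G\<^sup>2 / (4 * (G + q))"
      by (simp only: e(3))
    then show ?thesis
      by (simp only: e_def)
  qed
  then have "q + (c_star d - q)\<^sup>2 / (4 * c_star d) \<le> cur_qb s'"
    using qb q(1) by simp
  then show "q + (c_star d - q)\<^sup>2 / (4 * c_star d) \<le> qform d (stop_point s')"
    using stop_point_good(2)[OF good] by linarith
qed

lemma trajectory_good:
  assumes "trajectory d N S" and "2 \<le> CARD('n)" and "i \<le> N"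
  shows "good_state (S i)"
  using assms(3)
proof (induction i)
  case 0
  then show ?case
    using assms init_check_good by (auto simp: trajectory_def)
next
  case (Suc i)
  then show ?case
    using assms(1) next_check_step(1)[of "S i" "S (Suc i)"] by (auto simp: trajectory_def)
qed

end

subsection \<open>The convergence rate\<close>

text \<open>With \<open>x = 1/m\<close> the claim reduces to
  \<open>x - x\<^sup>2/4 \<le> 4x/(4 + x)\<close>, which holds because
  \<open>(4 - x)(4 + x) \<le> 16\<close>.\<close>

lemma sublinear_step:
  fixes r r' m :: real
  assumes "r' \<le> r - r\<^sup>2 / 4" and "0 \<le> r" and "r \<le> inverse m" and "1 \<le> m"
  shows "r' \<le> inverse (m + 1/4)"
proof -
  define x where "x = inverse m"
  have x: "0 < x" "x \<le> 1" "m = inverse x"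
    using assms(4) by (auto simp: x_def inverse_le_1_iff)
  \<comment> \<open>the map \<open>r \<mapsto> r - r\<^sup>2/4\<close> is increasing on \<open>[0, 2]\<close>\<close>
  have "0 \<le> (x - r) * (4 - x - r)"
    using assms(3) x(1,2) by (intro mult_nonneg_nonneg) (auto simp: x_def)
  then have "r - r\<^sup>2 / 4 \<le> x - x\<^sup>2 / 4"
    by (simp add: algebra_simps power2_eq_square)
  also have "\<dots> \<le> inverse (inverse x + 1/4)"
  proof -
    have "(x - x\<^sup>2 / 4) * (4 + x) = 4 * x - x ^ 3 / 4"
      by (simp add: algebra_simps power2_eq_square power3_eq_cube)
    also have "\<dots> \<le> 4 * x"
      using x(1) by simp
    finally have "x - x\<^sup>2 / 4 \<le> 4 * x / (4 + x)"
      using x(1) by (simp add: pos_le_divide_eq)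
    also have "\<dots> = inverse (inverse x + 1/4)"
      using x(1) by (simp add: field_simps)
    finally show ?thesis .
  qed
  finally show ?thesis
    using assms(1) unfolding x(3) by linarith
qed

theorem theorem12:
  fixes d :: "real^'n^'n" and S :: "nat \<Rightarrow> 'n check_state" and N i :: nat and r0 :: real
  assumes "CARD('n) \<ge> 2"
    and "\<And>i j. d $ i $ j = d $ j $ i"
    and "\<And>i. d $ i $ i = 0"
    and "\<And>i j. i \<noteq> j \<Longrightarrow> d $ i $ j > 0"
    and "strict_negative_type d"
    and "trajectory d N S"
    and "i \<le> N"
    and "r0 = 1 - cur_c (S 0) / c_star d"
  shows "1 - qform d (stop_point (S i)) / c_star d
           \<le> (if r0 = 0 then 0 else inverse (1 / r0 + real i / 4)) \<and>
         (if r0 = 0 then 0 else inverse (1 / r0 + real i / 4)) \<le> 4 / (real i + 4) \<and>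
         c_star d - qform d (stop_point (S i)) \<le> 4 * c_star d / (real i + 4) \<and>
         4 * c_star d / (real i + 4) \<le> 4 * d_max d / (real i + 4) \<and>
         qform d (stop_point (S i)) \<ge> cur_c (S i) \<and>
         qform d (stop_point (S i)) \<le> c_star d \<and>
         (check_holds (S i) \<longrightarrow>
            (\<forall>w qw Gw kw. shadow_choice d (S i) w qw Gw kw \<longrightarrow>
               c_star d \<in> {qform d (stop_point (S i)) .. qw + Gw}))"
proof -
  interpret negative_type_matrix d
    using assms by unfold_locales auto
  define c where "c = c_star d"
  define r where "r j = 1 - qform d (stop_point (S j)) / c" for j
  have good: "good_state (S j)" if "j \<le> N" for j
    using trajectory_good[OF assms(6,1)] that .
  have le: "qform d (stop_point (S j)) \<le> c" if "j \<le> N" for j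
    unfolding c_def using qform_le_c_star stop_point_good(1)[OF good[OF that]] .
  have c: "c > 0"
    using le[of 0] stop_point_good(3)[OF good[of 0]] by simp
  have r_nonneg: "0 \<le> r j" if "j \<le> N" for j
    using le[OF that] c by (simp add: r_def divide_simps)
  \<comment> \<open>This identifies \<open>r0\<close>, defined through \<open>c\<close>, with the
    initial term of the sequence \<open>r\<close>, defined through stop points.\<close>
  have "stop_point (S 0) = cur_p (S 0)"
    using init_check_good(2) assms(1,6) by (simp add: trajectory_def)
  then have r0: "r0 = r 0" "r0 \<le> 1"
    using good[of 0] assms(8) c by (auto simp: good_state_def r_def c_def)
  have r_step: "r (Suc j) \<le> r j - (r j)\<^sup>2 / 4" if "Suc j \<le> N" for j
  proof -
    let ?q = "qform d (stop_point (S j))"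
    have "?q + (c - ?q)\<^sup>2 / (4 * c) \<le> qform d (stop_point (S (Suc j)))"
      using next_check_step(2)[OF good[of j], of "S (Suc j)"] assms(6) that
      by (simp add: trajectory_def c_def)
    then have "(?q + (c - ?q)\<^sup>2 / (4 * c)) / c \<le> qform d (stop_point (S (Suc j))) / c"
      using c by (simp add: divide_right_mono)
    moreover have "1 - (?q + (c - ?q)\<^sup>2 / (4 * c)) / c = r j - (r j)\<^sup>2 / 4"
      using c by (simp add: r_def field_simps power2_eq_square)
    ultimately show ?thesis
      by (simp add: r_def)
  qed
  \<comment> \<open>Since \<open>1 / 0 = 0\<close> in HOL, the bare formula would give
    \<open>4 / i\<close> at \<open>r0 = 0\<close>; the case distinction restores the intended value
    0.\<close>
  let ?m = "if r0 = 0 then 0 else inverse (1 / r0 + real i / 4)"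
  have bound: "r i \<le> ?m \<and> ?m \<le> 4 / (real i + 4)"
  proof (cases "r0 = 0")
    case True
    have "r i \<le> 0"
      using \<open>i \<le> N\<close>
    proof (induction i)
      case 0
      then show ?case using True r0 by simp
    next
      case (Suc j)
      then have "r (Suc j) \<le> r j - (r j)\<^sup>2 / 4" "r j \<le> 0"
        using r_step[of j] by auto
      then show ?case
        using zero_le_power2[of "r j"] by linarith
    qed
    then show ?thesis using True by simp
  next
    case False
    \<comment> \<open>This starts the recursion for \<open>1/r\<close> at 1 or above, as
      \<open>sublinear_step\<close> requires, and yields the bound
      \<open>4 / (i + 4)\<close>.\<close>
    then have m: "1 / r0 \<ge> 1"
      using r0 r_nonneg[of 0] by (simp add: divide_simps)
    have "r i \<le> inverse (1 / r0 + real i / 4)"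
      using \<open>i \<le> N\<close>
    proof (induction i)
      case 0
      then show ?case using r0 by simp
    next
      case (Suc j)
      then have "r (Suc j) \<le> inverse ((1 / r0 + real j / 4) + 1/4)"
        using r_step[of j] r_nonneg[of j] m by (intro sublinear_step[of _ "r j"]) auto
      then show ?case
        by (simp add: add_divide_distrib algebra_simps)
    qed
    moreover have "inverse (1 / r0 + real i / 4) \<le> inverse (1 + real i / 4)"
      using m by (intro le_imp_inverse_le) auto
    moreover have "inverse (1 + real i / 4) = 4 / (real i + 4)"
      by (simp add: field_simps)
    ultimately show ?thesis
      using False by simp
  qed
  then have "r i * c \<le> 4 / (real i + 4) * c"
    using c by (intro mult_right_mono) auto
  moreover have "r i * c = c - qform d (stop_point (S i))"
    using c by (simp add: r_def field_simps)
  ultimately have diff: "c - qform d (stop_point (S i)) \<le> 4 * c / (real i + 4)"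
    by simp
  have dmax: "4 * c / (real i + 4) \<le> 4 * d_max d / (real i + 4)"
    using c_star_le_d_max[of d] by (intro divide_right_mono) (auto simp: c_def)
  show ?thesis
    using bound diff dmax le[OF \<open>i \<le> N\<close>] stop_point_good(2)[OF good[OF \<open>i \<le> N\<close>]]
      gap[OF good[OF \<open>i \<le> N\<close>]]
    unfolding c_def[symmetric] by (simp add: r_def)
qed

end
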